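(* Let $n\geq 1$ be an integer which is divisible by $3$. Then \[\left\lfloor\sum_{i=1}^{10^n}\sqrt[3]{i}\right\rfloor=\frac{3\cdot 10^{4n/3}}{4}+5\cdot 10^{n/3-1}-1.\]
   Context: Here $\sqrt[3]{i}$ denotes the real cube root of $i$ and $\lfloor\cdot\rfloor$ is the floor function. *)

theory Defs
  imports Complex_Main
begin

end

theory Submission
  imports Defs
begin

text \<open>
  Put \<open>a = root 3 m\<close> and \<open>b = root 3 (m + 1)\<close>. The trapezoidal rule for the cube root on \<open>[m, m + 1]\<close>
  falls short of the integral by exactly \<open>(b - a)^3 (a + b) / 4\<close>. This is positive, and since
  \<open>b - a = 1 / (a^2 + a b + b^2) \<le> 1 / (3 a b)\<close> it is at most \<open>(1 / a^2 - 1 / b^2) / 36\<close>, which telescopes.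
  Hence the sum up to \<open>N\<close> differs from \<open>3/4 N^(4/3) + 1/2 N^(1/3)\<close> by a quantity in \<open>[-5/18, -1/4]\<close>,
  and for \<open>N = 10^n\<close> the latter expression is an integer.
\<close>

lemma trapezoid_defect_cube_root:
  fixes a b :: real
  assumes "b ^ 3 = a ^ 3 + 1"
  shows "3 / 4 * (b ^ 4 - a ^ 4) - (a + b) / 2 = (b - a) ^ 3 * (a + b) / 4"
proof -
  \<comment> \<open>The factor \<open>b ^ 3 - a ^ 3\<close>, equal to 1, makes both sides
    homogeneous of degree 4, so the identity holds for all \<open>a\<close> and
    \<open>b\<close>.\<close>
  have "3 / 4 * (b ^ 4 - a ^ 4) - (a + b) / 2 * (b ^ 3 - a ^ 3) = (b - a) ^ 3 * (a + b) / 4"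
    by (simp add: field_simps power2_eq_square power3_eq_cube power4_eq_xxxx)
  then show ?thesis
    using assms by simp
qed

lemma trapezoid_defect_cube_root_le:
  fixes a b :: real
  assumes "0 < a" "a < b" "b ^ 3 = a ^ 3 + 1"
  shows "(b - a) ^ 3 * (a + b) / 4 \<le> 1 / (36 * a\<^sup>2) - 1 / (36 * b\<^sup>2)"
proof -
  have b: "0 < b" using assms by simp
  have "(b - a) * (3 * a * b) \<le> (b - a) * (a\<^sup>2 + a * b + b\<^sup>2)"
  proof (rule mult_left_mono)
    show "3 * a * b \<le> a\<^sup>2 + a * b + b\<^sup>2"
      using zero_le_power2[of "a - b"] by (simp add: power2_eq_square algebra_simps)
  qed (use assms in simp)
  also have "\<dots> = b ^ 3 - a ^ 3"
    by (simp add: power2_eq_square power3_eq_cube algebra_simps)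
  finally have "(b - a) * (3 * a * b) \<le> 1"
    using assms by simp
  then have "((b - a) * (3 * a * b))\<^sup>2 \<le> 1"
    using assms b by (intro power_le_one) auto
  \<comment> \<open>The factor in front is the telescoping difference itself; multiplied by the
    square it becomes the defect.\<close>
  then have "(b - a) * (a + b) / (36 * a\<^sup>2 * b\<^sup>2) * ((b - a) * (3 * a * b))\<^sup>2
      \<le> (b - a) * (a + b) / (36 * a\<^sup>2 * b\<^sup>2)"
    using assms b by (intro mult_left_le) auto
  moreover have "(b - a) * (a + b) / (36 * a\<^sup>2 * b\<^sup>2) * ((b - a) * (3 * a * b))\<^sup>2
      = (b - a) ^ 3 * (a + b) / 4"
    using assms(1) b by (simp add: divide_simps) (simp add: algebra_simps power2_eq_square power3_eq_cube)
  moreover have "(b - a) * (a + b) / (36 * a\<^sup>2 * b\<^sup>2) = 1 / (36 * a\<^sup>2) - 1 / (36 * b\<^sup>2)"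
    using assms b by (simp add: field_simps power2_eq_square)
  ultimately show ?thesis by linarith
qed

text \<open>Both bounds are equalities at \<open>m = 1\<close>, which fixes -1/4 and -5/18 = -1/4 -
  1/36. The term \<open>1 / (36 * r\<^sup>2)\<close> strengthens the lower bound so that the
  induction closes.\<close>

lemma sum_cube_roots_bounds:
  fixes m :: nat
  assumes "m \<ge> 1"
  defines "r \<equiv> root 3 (real m)"
  shows "(\<Sum>i = 1..m. root 3 (real i)) \<le> 3 / 4 * r ^ 4 + r / 2 - 1 / 4"
    and "3 / 4 * r ^ 4 + r / 2 - 5 / 18 + 1 / (36 * r\<^sup>2) \<le> (\<Sum>i = 1..m. root 3 (real i))"
proof -
  have "(\<Sum>i = 1..m. root 3 (real i)) \<le> 3 / 4 * root 3 (real m) ^ 4 + root 3 (real m) / 2 - 1 / 4 \<and>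
    3 / 4 * root 3 (real m) ^ 4 + root 3 (real m) / 2 - 5 / 18 + 1 / (36 * (root 3 (real m))\<^sup>2)
      \<le> (\<Sum>i = 1..m. root 3 (real i))"
    using assms(1)
  proof (induction m rule: nat_induct_at_least)
    case base
    then show ?case by simp
  next
    case (Suc m)
    define a b where "a = root 3 (real m)" and "b = root 3 (real (Suc m))"
    have ab: "0 < a" "a < b" "b ^ 3 = a ^ 3 + 1"
      using Suc.hyps by (auto simp: a_def b_def)
    define S where "S = (\<Sum>i = 1..m. root 3 (real i))"
    have sum: "(\<Sum>i = 1..Suc m. root 3 (real i)) = S + b"
      by (simp add: S_def b_def)
    \<comment> \<open>The main term 3/4 r^4 + r/2 grows by \<open>b + d\<close>, where 0 \<le>
      \<open>d\<close> \<le> \<open>u - v\<close>; with these names the step is linear.\<close>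
    define u v where "u = 1 / (36 * a\<^sup>2)" and "v = 1 / (36 * b\<^sup>2)"
    define d where "d = (b - a) ^ 3 * (a + b) / 4"
    have "0 \<le> d"
      using ab by (simp add: d_def)
    then show ?case
      using Suc.IH trapezoid_defect_cube_root[OF ab(3)] trapezoid_defect_cube_root_le[OF ab]
      unfolding sum S_def[symmetric] a_def[symmetric] b_def[symmetric] d_def[symmetric] u_def[symmetric] v_def[symmetric]
      by argo
  qed
  then show "(\<Sum>i = 1..m. root 3 (real i)) \<le> 3 / 4 * r ^ 4 + r / 2 - 1 / 4"
    and "3 / 4 * r ^ 4 + r / 2 - 5 / 18 + 1 / (36 * r\<^sup>2) \<le> (\<Sum>i = 1..m. root 3 (real i))"
    by (simp_all add: r_def)
qed

theorem theorem2:
  fixes n :: nat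
  assumes "n \<ge> 1" and "3 dvd n"
  shows "real_of_int \<lfloor>\<Sum>i = (1::nat)..10 ^ n. root 3 (real i)\<rfloor>
           = 3 * 10 powr (4 * real n / 3) / 4 + 5 * 10 powr (real n / 3 - 1) - 1"
proof -
  obtain j where n: "n = 3 * Suc j"
    using assms by (metis dvdE mult_0_right not_one_le_zero not0_implies_Suc)
  define S where "S = (\<Sum>i = (1::nat)..10 ^ n. root 3 (real i))"
  \<comment> \<open>Here 7500 = 3/4 * 10^4 and 5 = 10/2, from \<open>10 ^ Suc j\<close> as the cube
    root of \<open>10 ^ n\<close>. The bounds place \<open>S\<close> between \<open>z\<close> +
    13/18 and \<open>z\<close> + 3/4.\<close>
  define z :: int where "z = 7500 * 10 ^ (4 * j) + 5 * 10 ^ j - 1"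
  have "real (10 ^ n) = (10 ^ Suc j) ^ 3"
    unfolding n by (simp only: of_nat_power of_nat_numeral power_mult[symmetric] mult.commute)
  then have r: "root 3 (real (10 ^ n)) = 10 ^ Suc j"
    by (simp add: real_root_pos2 del: of_nat_power power_Suc)
  have z: "real_of_int z = 3 / 4 * (10 ^ Suc j) ^ 4 + 10 ^ Suc j / 2 - 1"
    unfolding z_def by (simp add: power_mult_distrib power_mult[symmetric] mult.commute)
  have "S \<le> 3 / 4 * (10 ^ Suc j) ^ 4 + 10 ^ Suc j / 2 - 1 / 4"
    using sum_cube_roots_bounds(1)[of "10 ^ n"] unfolding r S_def by simp
  moreover have "3 / 4 * (10 ^ Suc j) ^ 4 + 10 ^ Suc j / 2 - 5 / 18 + 1 / (36 * (10 ^ Suc j)\<^sup>2) \<le> S"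
    using sum_cube_roots_bounds(2)[of "10 ^ n"] unfolding r S_def by simp
  moreover have "0 \<le> 1 / (36 * (10 ^ Suc j)\<^sup>2 :: real)"
    by simp
  ultimately have "real_of_int z \<le> S" "S < real_of_int z + 1"
    unfolding z by linarith+
  then have floor: "\<lfloor>S\<rfloor> = z"
    by (simp add: floor_eq_iff)
  have e: "4 * real n / 3 = real (4 * Suc j)" "real n / 3 - 1 = real j"
    unfolding n by (simp_all add: field_simps)
  have "10 powr (4 * real n / 3) = (10 ^ (4 * Suc j) :: real)" "10 powr (real n / 3 - 1) = (10 ^ j :: real)"
    unfolding e by (simp_all only: powr_realpow zero_less_numeral)
  then show ?thesis
    unfolding S_def[symmetric] floor z_def by (simp add: power_add)
qed

end
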